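(* Let $n\ge2$, $\mathbf{d}=(d_1,\dots,d_s)$ with $1\le d_1<\dots<d_s<n$, and let $\mathbf{m},\mathbf{m}'\in\mathbb{Z}_{\ge0}^{n-1}$ satisfy $m_i=m'_i=0$ unless $i=d_a$ for some $a$. Then for any integers $M,M'\ge0$ one has $$S_{\mathbf{d},\mathbf{m},M}+S_{\mathbf{d},\mathbf{m}',M'}=S_{\mathbf{d},\mathbf{m}+\mathbf{m}',M+M'},\qquad X_{\mathbf{d},\mathbf{m},M}+X_{\mathbf{d},\mathbf{m}',M'}=X_{\mathbf{d},\mathbf{m}+\mathbf{m}',M+M'}.$$
   Context: Let $P=\{(i,j):1\le j<i\le n\}$ be the poset with $(i,j)\le(i_1,j_1)$ iff $i\le i_1$ and $j\le j_1$. For $1\le d\le n-1$, $P_d=\{(i,j)\in P:i>d\ge j\}$. Put $P_{\mathbf{d}}=\bigcup_{a=1}^sP_{d_a}$ with the induced order. $w(R)$ is the width of a finite poset $R$ (maximal size of an antichain, $w(\emptyset)=0$). For $\mathbf{m}\in\mathbb{Z}_{\ge0}^{n-1}$ with $m_i=0$ unless $i\in\{d_1,\dots,d_s\}$ and an integer $M\ge0$, $X_{\mathbf{d},\mathbf{m},M}\subset\mathbb{R}_{\ge0}^{P_{\mathbf{d}}}$ is the set of points $(x_\alpha)_{\alpha\in P_{\mathbf{d}}}$ with nonnegative coordinates such that for every subset $P'\subset P_{\mathbf{d}}$ $$\sum_{\alpha\in P'}x_\alpha\le M+\sum_{a=1}^sm_{d_a}w(P'\cap P_{d_a}),$$ and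 $S_{\mathbf{d},\mathbf{m},M}=X_{\mathbf{d},\mathbf{m},M}\cap\mathbb{Z}^{P_{\mathbf{d}}}$. Sums of sets are Minkowski sums. *)

theory Defs
  imports "HOL-Analysis.Analysis" "HOL-Library.Set_Algebras" "HOL-Library.Function_Algebras"
    "HOL-Library.Product_Order"
begin

definition antichain :: "'a::order set \<Rightarrow> bool" where
  "antichain A \<longleftrightarrow> pairwise (\<lambda>x y. \<not> x \<le> y) A"

text \<open>Only meaningful for finite \<open>R\<close>.\<close>

definition width :: "'a::order set \<Rightarrow> nat" where
  "width R = Max (card ` {A. A \<subseteq> R \<and> antichain A})"

lemma width_empty: "width {} = 0"
proof -
  have "{A. A \<subseteq> {} \<and> antichain A} = {{} :: 'a set}"
    by (auto simp: antichain_def)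
  then show ?thesis by (simp add: width_def)
qed

text \<open>The order on these pairs is the componentwise one of
  \<^theory>\<open>HOL-Library.Product_Order\<close>.\<close>

definition P_all :: "nat \<Rightarrow> (nat \<times> nat) set" where
  "P_all n = {(i, j). 1 \<le> j \<and> j < i \<and> i \<le> n}"

definition P_single :: "nat \<Rightarrow> nat \<Rightarrow> (nat \<times> nat) set" where
  "P_single n k = {(i, j) \<in> P_all n. k < i \<and> j \<le> k}"

definition P_union :: "nat \<Rightarrow> nat list \<Rightarrow> (nat \<times> nat) set" where
  "P_union n d = (\<Union>a<length d. P_single n (d ! a))"

text \<open>A point of \<open>\<real>\<^sup>I\<close> with \<open>I = P_union n d\<close> is encoded as a function on all pairs that
  vanishes outside \<open>I\<close>; this encoding is compatible with pointwise addition, so the Minkowski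
  sum is the sum of sets of functions from \<^theory>\<open>HOL-Library.Set_Algebras\<close> and
  \<^theory>\<open>HOL-Library.Function_Algebras\<close>. The tuple \<open>d\<close> is a list, indexed from 0. Of a
  vector \<open>m\<close> with entries indexed by \<open>1, \<dots>, n - 1\<close> only these values are used.\<close>

definition X_set :: "nat \<Rightarrow> nat list \<Rightarrow> (nat \<Rightarrow> nat) \<Rightarrow> nat \<Rightarrow> (nat \<times> nat \<Rightarrow> real) set" where
  "X_set n d m M =
    {x. (\<forall>\<alpha>. \<alpha> \<notin> P_union n d \<longrightarrow> x \<alpha> = 0) \<and>
        (\<forall>\<alpha>\<in>P_union n d. 0 \<le> x \<alpha>) \<and>
        (\<forall>P'. P' \<subseteq> P_union n d \<longrightarrow>
          (\<Sum>\<alpha>\<in>P'. x \<alpha>)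
            \<le> real M + (\<Sum>a<length d. real (m (d ! a)) * real (width (P' \<inter> P_single n (d ! a)))))}"

definition S_set :: "nat \<Rightarrow> nat list \<Rightarrow> (nat \<Rightarrow> nat) \<Rightarrow> nat \<Rightarrow> (nat \<times> nat \<Rightarrow> real) set" where
  "S_set n d m M = X_set n d m M \<inter> {x. \<forall>\<alpha>\<in>P_union n d. x \<alpha> \<in> \<int>}"

end

theory Submission
  imports Defs "HOL-Combinatorics.Cycles"
begin

text \<open>
  Adding the inequalities gives the inclusions from left to right. The content is that a point \<open>x\<close> of the
  polytope for \<open>\<mu> = m + m'\<close> and \<open>M + M'\<close> splits, and that the parts are integral if \<open>x\<close> is. Put
  \<open>\<Lambda>(k) = \<mu>\<^sub>0 + \<dots> + \<mu>\<^sub>k\<^sub>-\<^sub>1\<close> (with \<open>\<mu>\<^sub>a = 0\<close> unless \<open>a\<close> occurs in \<open>d\<close>). The proof represents \<open>x\<close>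
  by intervals on the real line. To each pair \<open>\<alpha> = (i, j)\<close> it assigns a half-open interval
  \<open>[l \<alpha>, h \<alpha>)\<close>, possibly empty, inside \<open>[\<Lambda>(j), \<Lambda>(i))\<close> and of length at most \<open>x \<alpha>\<close>, such that
  \<open>h \<alpha> \<le> l \<beta>\<close> whenever \<open>\<alpha> < \<beta>\<close>, and such that the lengths fall short of \<open>x\<close> by at most \<open>M + M'\<close>
  in total.

  From such intervals the decomposition can be read off. The \<open>\<alpha>\<close> whose intervals contain a given
  point \<open>t\<close> form an antichain, and if \<open>\<Lambda>(a) \<le> t < \<Lambda>(a + 1)\<close> this antichain lies in \<open>P\<^sub>a\<close>. So the
  lengths of the overlaps with a piece of \<open>[\<Lambda>(a), \<Lambda>(a + 1))\<close> of length \<open>c\<close> have a sum of at most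
  \<open>c * w(P' \<inter> P\<^sub>a)\<close> over any \<open>P'\<close> (lemma \<open>sum_overlap_le_width\<close>). Cut each \<open>[\<Lambda>(a), \<Lambda>(a + 1))\<close>
  into a piece of length \<open>m\<^sub>a\<close> and a piece of length \<open>m'\<^sub>a\<close>: overlaps with pieces of the first kind
  go to the first summand, the others to the second, and the shortfall, whose total is at most
  \<open>M + M'\<close>, is shared out greedily.

  The intervals exist by linear programming duality (lemma \<open>interval_representation\<close>). They are
  given by a dual solution of an assignment problem on the pairs: a permutation is a
  union of cycles, each cycle is cut into chains, and its gain is the sum of \<open>x\<close> over the points
  used, minus a cost for the intervals of levels that the chains span. If chains cover
  \<open>P'\<close>, at least \<open>w(P' \<inter> P\<^sub>a)\<close> of them meet \<open>P\<^sub>a\<close>, so the inequalities defining the polytope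
  imply that no permutation gains more than \<open>M + M'\<close> (lemma \<open>sum_gain_le\<close>). Optimal permutations have
  potentials, and these are computed from the data by sums and maxima only; the same argument
  therefore works over the reals and over the integers.
\<close>

section \<open>Duality for the assignment problem\<close>

text \<open>Additive subgroups. Every construction below stays inside a fixed subgroup \<open>G\<close>; the integral
  and the real form of the theorem are the cases \<open>G = \<int>\<close> and \<open>G = \<real>\<close>.\<close>

definition diff_closed :: "'b::ab_group_add set \<Rightarrow> bool" where
  "diff_closed G \<longleftrightarrow> 0 \<in> G \<and> (\<forall>a\<in>G. \<forall>b\<in>G. a - b \<in> G)"

lemma diff_closed_zero: "diff_closed G \<Longrightarrow> 0 \<in> G"
  and diff_closed_diff: "diff_closed G \<Longrightarrow> a \<in> G \<Longrightarrow> b \<in> G \<Longrightarrow> a - b \<in> G"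
  by (auto simp: diff_closed_def)

lemma diff_closed_add: "diff_closed G \<Longrightarrow> a \<in> G \<Longrightarrow> b \<in> G \<Longrightarrow> a + b \<in> G"
  using diff_closed_diff[of G a "0 - b"] diff_closed_diff[of G 0 b] diff_closed_zero[of G] by simp

lemma diff_closed_sum:
  assumes "diff_closed G" "\<And>a. a \<in> A \<Longrightarrow> f a \<in> G"
  shows "sum f A \<in> G"
  using assms(2) by (induction A rule: infinite_finite_induct)
    (auto simp: diff_closed_zero[OF assms(1)] intro: diff_closed_add[OF assms(1)])

fun path_weight :: "('a \<Rightarrow> 'a \<Rightarrow> 'b::ab_group_add) \<Rightarrow> 'a list \<Rightarrow> 'b" where
  "path_weight c (x # y # zs) = c x y + path_weight c (y # zs)"
| "path_weight c _ = 0"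

lemma path_weight_append:
  "path_weight c (xs @ y # ys) = path_weight c (xs @ [y]) + path_weight c (y # ys)"
proof (induction xs)
  case (Cons x xs)
  then show ?case by (cases xs) (simp_all add: add.assoc)
qed simp

lemma path_weight_closed:
  assumes "diff_closed G" "\<And>x y. x \<in> N \<Longrightarrow> y \<in> N \<Longrightarrow> c x y \<in> G" "set xs \<subseteq> N"
  shows "path_weight c xs \<in> G"
  using assms(2,3) by (induction c xs rule: path_weight.induct)
    (auto simp: diff_closed_zero[OF assms(1)] intro!: diff_closed_add[OF assms(1)])

lemma path_weight_snoc:
  "path_weight c (xs @ [y]) = sum_list (map2 c xs (tl xs @ [y]))"
proof (induction xs)
  case (Cons x xs)
  then show ?case by (cases xs) simp_all
qed simp

lemma path_weight_closed_walk:
  assumes "distinct cs" "cs \<noteq> []"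
  shows "path_weight c (cs @ [hd cs]) = (\<Sum>x\<in>set cs. c x (cycle_of_list cs x))"
proof -
  have rot: "map (cycle_of_list cs) cs = tl cs @ [hd cs]"
    using cyclic_rotation[OF assms(1), of 1] assms(2) by (cases cs) simp_all
  have "path_weight c (cs @ [hd cs]) = sum_list (map2 c cs (map (cycle_of_list cs) cs))"
    by (simp add: path_weight_snoc rot)
  also have "map2 c cs (map (cycle_of_list cs) cs) = map (\<lambda>x. c x (cycle_of_list cs x)) cs"
    by (rule nth_equalityI) simp_all
  finally show ?thesis
    using assms(1) by (simp add: sum_list_distinct_conv_sum_set)
qed

text \<open>The potential of \<open>a\<close> is the largest weight of a path without repetitions that starts at \<open>a\<close>.
  Extending an optimal path from \<open>b\<close> by the edge from \<open>a\<close> to \<open>b\<close> either gives another such path or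
  closes a cycle, which can be dropped since its weight is at most 0.\<close>

lemma potential_if_no_positive_cycle:
  fixes c :: "'a \<Rightarrow> 'a \<Rightarrow> 'b::linordered_ab_group_add"
  assumes fin: "finite N" and G: "diff_closed G"
    and c: "\<And>x y. x \<in> N \<Longrightarrow> y \<in> N \<Longrightarrow> c x y \<in> G"
    and cyc: "\<And>cs. distinct cs \<Longrightarrow> cs \<noteq> [] \<Longrightarrow> set cs \<subseteq> N \<Longrightarrow> path_weight c (cs @ [hd cs]) \<le> 0"
  shows "\<exists>u. (\<forall>a\<in>N. u a \<in> G) \<and> (\<forall>a\<in>N. \<forall>b\<in>N. c a b + u b \<le> u a)"
proof -
  define L where "L a = {xs. (set xs \<subseteq> N \<and> distinct xs) \<and> xs \<noteq> [] \<and> hd xs = a}" for a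
  define u where "u a = Max (path_weight c ` L a)" for a
  have finL: "finite (L a)" for a
    unfolding L_def by (rule finite_subset[OF _ finite_subset_distinct[OF fin]]) auto
  have best: "\<exists>xs\<in>L a. u a = path_weight c xs" if "a \<in> N" for a
  proof -
    have "[a] \<in> L a" using that by (simp add: L_def)
    then have "u a \<in> path_weight c ` L a"
      unfolding u_def using finL by (intro Max_in) auto
    then show ?thesis by auto
  qed
  have le: "path_weight c xs \<le> u a" if "xs \<in> L a" for xs a
    unfolding u_def using that finL by (intro Max_ge) auto
  show ?thesis
  proof (intro exI conjI ballI)
    show "u a \<in> G" if "a \<in> N" for a
      using best[OF that] path_weight_closed[OF G c] by (auto simp: L_def)
    fix a b assume ab: "a \<in> N" "b \<in> N"
    obtain xs where xs: "xs \<in> L b" "u b = path_weight c xs" using best ab by blast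
    then have prem: "set xs \<subseteq> N" "distinct xs" "xs \<noteq> []" "hd xs = b" by (auto simp: L_def)
    have step: "path_weight c (a # xs) = c a b + path_weight c xs"
      using prem by (cases xs) auto
    show "c a b + u b \<le> u a"
    proof (cases "a \<in> set xs")
      case False
      then have "a # xs \<in> L a" using prem ab by (simp add: L_def)
      then show ?thesis using le step xs(2) by metis
    next
      case True
      then obtain ys zs where split: "xs = ys @ a # zs" by (meson split_list)
      have "path_weight c (a # xs) = path_weight c ((a # ys) @ [a]) + path_weight c (a # zs)"
        using path_weight_append[of c "a # ys" a zs] split by simp
      moreover have "path_weight c ((a # ys) @ [hd (a # ys)]) \<le> 0"
        using prem split ab by (intro cyc) auto
      moreover have "path_weight c (a # zs) \<le> u a"
        using prem split by (intro le) (auto simp: L_def)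
      ultimately have "path_weight c (a # xs) \<le> 0 + u a"
        by (metis add_mono list.sel(1))
      then show ?thesis using step xs(2) by simp
    qed
  qed
qed

text \<open>Duality for the assignment problem (Egervary). A permutation of maximal total weight leaves no
  profitable cyclic exchange, so the weights of the exchanges admit a potential. The
  potential is a maximum of finitely many sums of differences of weights, so \<open>u\<close> and \<open>v\<close> stay
  in \<open>G\<close>.\<close>

lemma assignment_duality:
  fixes W :: "'a \<Rightarrow> 'a \<Rightarrow> 'b::linordered_ab_group_add"
  assumes fin: "finite N" and G: "diff_closed G"
    and W: "\<And>a b. a \<in> N \<Longrightarrow> b \<in> N \<Longrightarrow> W a b \<in> G"
  shows "\<exists>\<sigma> u v. \<sigma> permutes N \<and> (\<forall>a\<in>N. u a \<in> G) \<and> (\<forall>a\<in>N. v a \<in> G) \<and>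
    (\<forall>a\<in>N. \<forall>b\<in>N. W a b \<le> u a + v b) \<and> sum u N + sum v N = (\<Sum>a\<in>N. W a (\<sigma> a))"
proof -
  define val where "val \<sigma> = (\<Sum>a\<in>N. W a (\<sigma> a))" for \<sigma>
  have "Max (val ` {\<sigma>. \<sigma> permutes N}) \<in> val ` {\<sigma>. \<sigma> permutes N}"
    using finite_permutations[OF fin] permutes_id[of N] by (intro Max_in) blast+
  then obtain \<sigma> where \<sigma>: "\<sigma> permutes N" and "val \<sigma> = Max (val ` {\<sigma>. \<sigma> permutes N})"
    by auto
  then have opt: "val \<tau> \<le> val \<sigma>" if "\<tau> permutes N" for \<tau>
    using that finite_permutations[OF fin] by auto
  \<comment> \<open>The change in value when \<open>a\<close> takes over the partner of \<open>b\<close>, booked against the loss of \<open>b\<close>.\<close>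
  define c where "c a b = W a (\<sigma> b) - W b (\<sigma> b)" for a b
  have \<sigma>N: "\<sigma> a \<in> N \<longleftrightarrow> a \<in> N" for a using \<sigma> by (simp add: permutes_in_image)
  have cG: "c a b \<in> G" if "a \<in> N" "b \<in> N" for a b
    unfolding c_def using that \<sigma>N by (intro diff_closed_diff[OF G] W) auto
  have cyc: "path_weight c (cs @ [hd cs]) \<le> 0"
    if cs: "distinct cs" "cs \<noteq> []" "set cs \<subseteq> N" for cs
  proof -
    define \<pi> where "\<pi> = cycle_of_list cs"
    have \<pi>: "\<pi> permutes N"
      unfolding \<pi>_def using cycle_permutes permutes_subset cs(3) by blast
    have "path_weight c (cs @ [hd cs]) = (\<Sum>x\<in>set cs. c x (\<pi> x))"
      unfolding \<pi>_def by (rule path_weight_closed_walk[OF cs(1,2)])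
    also have "\<dots> = (\<Sum>x\<in>N. c x (\<pi> x))"
      using fin cs(3) by (intro sum.mono_neutral_left) (auto simp: \<pi>_def c_def id_outside_supp)
    also have "\<dots> = val (\<sigma> \<circ> \<pi>) - (\<Sum>x\<in>N. W (\<pi> x) (\<sigma> (\<pi> x)))"
      by (simp add: c_def val_def sum_subtractf)
    also have "(\<Sum>x\<in>N. W (\<pi> x) (\<sigma> (\<pi> x))) = val \<sigma>"
      using sum.permute[OF \<pi>, of "\<lambda>x. W x (\<sigma> x)"] by (simp add: val_def o_def)
    finally show ?thesis using opt[OF permutes_compose[OF \<pi> \<sigma>]] by (simp add: o_def)
  qed
  obtain u where u: "\<And>a. a \<in> N \<Longrightarrow> u a \<in> G"
    and uc: "\<And>a b. a \<in> N \<Longrightarrow> b \<in> N \<Longrightarrow> c a b + u b \<le> u a"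
    using potential_if_no_positive_cycle[OF fin G cG cyc] by blast
  define v where "v b = W (inv \<sigma> b) b - u (inv \<sigma> b)" for b
  have inv: "inv \<sigma> b \<in> N" if "b \<in> N" for b
    using that permutes_in_image[OF permutes_inv[OF \<sigma>]] by simp
  have \<sigma>inv: "\<sigma> (inv \<sigma> b) = b" "inv \<sigma> (\<sigma> b) = b" for b
    using permutes_inverses[OF \<sigma>] by auto
  show ?thesis
  proof (intro exI conjI ballI)
    show "\<sigma> permutes N" by fact
    show "u a \<in> G" if "a \<in> N" for a using u that .
    show "v a \<in> G" if "a \<in> N" for a
      unfolding v_def using that inv by (intro diff_closed_diff[OF G] W u)
    show "W a b \<le> u a + v b" if "a \<in> N" "b \<in> N" for a b
      using uc[of a "inv \<sigma> b"] that inv by (simp add: c_def v_def \<sigma>inv algebra_simps)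
    have "sum v N = (\<Sum>a\<in>N. v (\<sigma> a))"
      using sum.permute[OF \<sigma>, of v] by (simp add: o_def)
    then show "sum u N + sum v N = (\<Sum>a\<in>N. W a (\<sigma> a))"
      by (simp add: v_def \<sigma>inv sum_subtractf)
  qed
qed

section \<open>Width\<close>

lemma card_le_width:
  assumes "finite R" "A \<subseteq> R" "antichain A"
  shows "card A \<le> width R"
  unfolding width_def using assms by (intro Max_ge) auto

lemma antichain_of_size_width:
  assumes "finite R"
  obtains A where "A \<subseteq> R" "antichain A" "card A = width R"
proof -
  have "width R \<in> card ` {A. A \<subseteq> R \<and> antichain A}"
    unfolding width_def using assms
    by (intro Max_in) (auto simp: antichain_def intro!: exI[of _ "{}"])
  then show thesis using that by auto
qed

text \<open>This is the easy half of Dilworth's theorem: the edges \<open>e \<mapsto> f e\<close> link \<open>C\<close> into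
  \<open>card C - card E\<close> chains, and no antichain is larger than the number of chains. For a maximum
  antichain \<open>A\<close>, edges starting on or above \<open>A\<close> end strictly above \<open>A\<close>, and any other edge is charged
  to its starting point, so the points of \<open>A\<close> are never charged.\<close>

lemma width_plus_card_edges_le:
  fixes C :: "'a::order set"
  assumes fin: "finite C" and inj: "inj_on f E" and E: "E \<subseteq> C"
    and fE: "\<And>e. e \<in> E \<Longrightarrow> f e \<in> C \<and> e < f e"
  shows "width C + card E \<le> card C"
proof -
  obtain A where A: "A \<subseteq> C" "antichain A" "card A = width C"
    using antichain_of_size_width[OF fin] .
  define U where "U = {c \<in> C. \<exists>a\<in>A. a < c}"
  have AU: "A \<inter> U = {}"
    using A(2) by (force simp: antichain_def pairwise_def U_def)
  have U: "U \<subseteq> C" by (auto simp: U_def)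
  note fins = fin finite_subset[OF E fin] finite_subset[OF U fin] finite_subset[OF A(1) fin]
  have "card E \<le> card (E \<inter> (U \<union> A)) + card (E - (U \<union> A))"
    using card_Un_le[of "E \<inter> (U \<union> A)" "E - (U \<union> A)"] by (simp add: Int_Diff_Un)
  also have "card (E \<inter> (U \<union> A)) = card (f ` (E \<inter> (U \<union> A)))"
    by (rule card_image[symmetric]) (rule inj_on_subset[OF inj], simp)
  also have "\<dots> \<le> card U"
    using fE by (intro card_mono fins) (force simp: U_def intro: less_trans)
  also have "card (E - (U \<union> A)) \<le> card (C - (U \<union> A))"
    using E fin by (intro card_mono) auto
  also have "card (C - (U \<union> A)) = card C - (card U + card A)"
    using U A(1) AU fins by (simp add: card_Diff_subset card_Un_disjoint Int_commute)
  finally have "card E \<le> card U + (card C - (card U + card A))" by simp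
  moreover have "card U + card A \<le> card C"
    using card_mono[OF fin, of "U \<union> A"] U A(1) AU fins
    by (simp add: card_Un_disjoint Int_commute)
  ultimately show ?thesis using A(3) by simp
qed

section \<open>Overlaps of intervals\<close>

text \<open>The length of \<open>[l, h) \<inter> [p, q)\<close>, given by a formula that visibly stays in a subgroup containing
  the end points.\<close>

definition overlap :: "real \<Rightarrow> real \<Rightarrow> real \<Rightarrow> real \<Rightarrow> real" where
  "overlap l h p q = max 0 (min h q - max l p)"

lemma overlap_nonneg: "0 \<le> overlap l h p q"
  by (simp add: overlap_def)

lemma overlap_add:
  assumes "p \<le> q" "q \<le> r"
  shows "overlap l h p q + overlap l h q r = overlap l h p r"
  using assms by (auto simp: overlap_def max_def min_def)

lemma overlap_closed:
  assumes "diff_closed G" "l \<in> G" "h \<in> G" "p \<in> G" "q \<in> G"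
  shows "overlap l h p q \<in> G"
  using assms diff_closed_diff[OF assms(1)] diff_closed_zero[OF assms(1)]
  by (auto simp: overlap_def max_def min_def)

lemma overlap_measure: "overlap l h p q = measure lborel ({l..<h} \<inter> {p..<q})"
  by (simp add: overlap_def max_def min_def Int_atLeastLessThan)

text \<open>Integrate over \<open>t \<in> [p, q)\<close> the number of intervals containing \<open>t\<close>: the intervals of comparable
  elements are disjoint, so this number is the size of an antichain in \<open>P \<inter> C\<close>.\<close>

lemma sum_overlap_le_width:
  fixes P :: "'a::order set"
  assumes fin: "finite P" and pq: "p \<le> q"
    and C: "\<And>\<alpha> t. \<alpha> \<in> P \<Longrightarrow> l \<alpha> \<le> t \<Longrightarrow> t < h \<alpha> \<Longrightarrow> p \<le> t \<Longrightarrow> t < q \<Longrightarrow> \<alpha> \<in> C"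
    and ord: "\<And>\<alpha> \<beta>. \<alpha> \<in> P \<Longrightarrow> \<beta> \<in> P \<Longrightarrow> \<alpha> < \<beta> \<Longrightarrow> h \<alpha> \<le> l \<beta>"
  shows "(\<Sum>\<alpha>\<in>P. overlap (l \<alpha>) (h \<alpha>) p q) \<le> (q - p) * width (P \<inter> C)"
proof -
  define I where "I \<alpha> = {l \<alpha>..<h \<alpha>} \<inter> {p..<q}" for \<alpha>
  have pointwise: "(\<Sum>\<alpha>\<in>P. indicator (I \<alpha>) t :: real) \<le> real (width (P \<inter> C)) * indicator {p..<q} t" for t
  proof (cases "t \<in> {p..<q}")
    case True
    define A where "A = {\<alpha> \<in> P. t \<in> I \<alpha>}"
    have "antichain A"
      using ord by (fastforce simp: antichain_def pairwise_def A_def I_def order.order_iff_strict)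
    moreover have "A \<subseteq> P \<inter> C" using C by (auto simp: A_def I_def)
    ultimately have "card A \<le> width (P \<inter> C)" using fin by (intro card_le_width) auto
    moreover have "(\<Sum>\<alpha>\<in>P. indicator (I \<alpha>) t) = real (card A)"
      using fin by (simp add: indicator_def A_def sum.If_cases Int_def)
    ultimately show ?thesis using True by simp
  next
    case False
    then show ?thesis by (auto simp: I_def intro!: sum_nonpos)
  qed
  have int: "integrable lborel (indicator (I \<alpha>) :: real \<Rightarrow> real)" for \<alpha>
  proof (rule integrable_real_indicator)
    show "emeasure lborel (I \<alpha>) < \<infinity>"
      by (rule le_less_trans[OF emeasure_mono[of _ "{p..<q}"]])
        (use pq in \<open>auto simp: I_def Int_atLeastLessThan\<close>)
  qed (simp add: I_def)
  have "integrable lborel (indicator {p..<q} :: real \<Rightarrow> real)"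
    using pq by (intro integrable_real_indicator) auto
  note int = int this
  have "(\<Sum>\<alpha>\<in>P. overlap (l \<alpha>) (h \<alpha>) p q) = (\<Sum>\<alpha>\<in>P. \<integral>t. indicator (I \<alpha>) t \<partial>lborel)"
    by (simp add: overlap_measure I_def)
  also have "\<dots> = (\<integral>t. (\<Sum>\<alpha>\<in>P. indicator (I \<alpha>) t) \<partial>lborel)"
    using int by (subst Bochner_Integration.integral_sum) auto
  also have "\<dots> \<le> (\<integral>t. real (width (P \<inter> C)) * indicator {p..<q} t \<partial>lborel)"
    using int pointwise by (intro integral_mono Bochner_Integration.integrable_sum) auto
  also have "\<dots> = (q - p) * width (P \<inter> C)"
    using pq by (simp add: mult.commute)
  finally show ?thesis .
qed

lemma split_under_budget:
  fixes z :: "'a \<Rightarrow> 'b::linordered_ab_group_add"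
  assumes "finite N" and G: "diff_closed G"
    and "\<And>\<alpha>. \<alpha> \<in> N \<Longrightarrow> 0 \<le> z \<alpha>" "\<And>\<alpha>. \<alpha> \<in> N \<Longrightarrow> z \<alpha> \<in> G"
    and "0 \<le> M" "0 \<le> M'" "M \<in> G" "M' \<in> G" "sum z N \<le> M + M'"
  shows "\<exists>y. (\<forall>\<alpha>\<in>N. 0 \<le> y \<alpha> \<and> y \<alpha> \<le> z \<alpha> \<and> y \<alpha> \<in> G) \<and> sum y N \<le> M \<and> sum (\<lambda>\<alpha>. z \<alpha> - y \<alpha>) N \<le> M'"
  using assms(1,3-)
proof (induction N arbitrary: M M' rule: finite_induct)
  case (insert p N)
  define t where "t = min (z p) M"
  have z: "0 \<le> z p" "z p \<in> G" and sum: "z p + sum z N \<le> M + M'" "0 \<le> sum z N"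
    using insert.prems insert.hyps by (auto intro: sum_nonneg)
  have t: "0 \<le> t" "t \<le> z p" "t \<le> M" "t \<in> G"
    using z insert.prems by (auto simp: t_def min_def)
  have "z p - t \<le> M'"
  proof (cases "z p \<le> M")
    case False
    then show ?thesis using order_trans[OF add_increasing2[OF sum(2) order_refl] sum(1)]
      by (simp add: t_def min_def algebra_simps)
  qed (use insert.prems in \<open>simp add: t_def\<close>)
  moreover have "sum z N \<le> (M - t) + (M' - (z p - t))"
    using sum by (simp add: algebra_simps)
  moreover have "M - t \<in> G" "M' - (z p - t) \<in> G"
    using insert.prems t z by (auto intro: diff_closed_diff[OF G])
  ultimately obtain y where y: "\<forall>\<alpha>\<in>N. 0 \<le> y \<alpha> \<and> y \<alpha> \<le> z \<alpha> \<and> y \<alpha> \<in> G"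
      "sum y N \<le> M - t" "sum (\<lambda>\<alpha>. z \<alpha> - y \<alpha>) N \<le> M' - (z p - t)"
    using insert.IH[of "M - t" "M' - (z p - t)"] insert.prems(1,2) t(3)
    by (metis (no_types, lifting) diff_ge_0_iff_ge insertCI)
  have "sum (y(p := t)) N = sum y N" "sum (\<lambda>\<alpha>. z \<alpha> - (y(p := t)) \<alpha>) N = sum (\<lambda>\<alpha>. z \<alpha> - y \<alpha>) N"
    using insert.hyps by (auto intro!: sum.cong)
  with y t insert.hyps show ?case
    by (intro exI[of _ "y(p := t)"]) (auto simp: algebra_simps)
qed auto

section \<open>Posets with monotone interval labels\<close>

text \<open>The poset of pairs enters only through its labels: \<open>(i, j)\<close> belongs to \<open>P\<^sub>a\<close> iff \<open>j \<le> a < i\<close>, and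
  both ends of this range of levels are monotone in the pair.\<close>

locale interval_labelled_poset =
  fixes N :: "'a::order set" and lo hi :: "'a \<Rightarrow> nat" and n :: nat
  assumes finite_N: "finite N"
    and lo_less_hi: "\<alpha> \<in> N \<Longrightarrow> lo \<alpha> < hi \<alpha>"
    and hi_le_n: "\<alpha> \<in> N \<Longrightarrow> hi \<alpha> \<le> n"
    and lo_mono: "\<alpha> \<in> N \<Longrightarrow> \<beta> \<in> N \<Longrightarrow> \<alpha> \<le> \<beta> \<Longrightarrow> lo \<alpha> \<le> lo \<beta>"
    and hi_mono: "\<alpha> \<in> N \<Longrightarrow> \<beta> \<in> N \<Longrightarrow> \<alpha> \<le> \<beta> \<Longrightarrow> hi \<alpha> \<le> hi \<beta>"
begin

definition layer :: "nat \<Rightarrow> 'a set" where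
  "layer a = {\<alpha> \<in> N. lo \<alpha> \<le> a \<and> a < hi \<alpha>}"

definition polytope :: "(nat \<Rightarrow> real) \<Rightarrow> real \<Rightarrow> ('a \<Rightarrow> real) set" where
  "polytope m M =
    {x. (\<forall>\<alpha>. \<alpha> \<notin> N \<longrightarrow> x \<alpha> = 0) \<and> (\<forall>\<alpha>\<in>N. 0 \<le> x \<alpha>) \<and>
        (\<forall>P. P \<subseteq> N \<longrightarrow> sum x P \<le> M + (\<Sum>a<n. m a * width (P \<inter> layer a)))}"

lemma polytope_add:
  assumes "x \<in> polytope m M" "y \<in> polytope m' M'"
  shows "x + y \<in> polytope (m + m') (M + M')"
proof -
  have "sum (x + y) P \<le> M + M' + (\<Sum>a<n. (m + m') a * width (P \<inter> layer a))" if "P \<subseteq> N" for P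
  proof -
    have "sum (x + y) P = sum x P + sum y P" by (simp add: sum.distrib)
    also have "\<dots> \<le> (M + (\<Sum>a<n. m a * width (P \<inter> layer a)))
        + (M' + (\<Sum>a<n. m' a * width (P \<inter> layer a)))"
      using assms that by (intro add_mono) (auto simp: polytope_def)
    finally show ?thesis by (simp add: algebra_simps sum.distrib)
  qed
  then show ?thesis using assms by (auto simp: polytope_def)
qed

text \<open>Level \<open>a\<close> occupies the segment from \<open>height \<mu> a\<close> to \<open>height \<mu> (Suc a)\<close> of the real line.\<close>

definition height :: "(nat \<Rightarrow> real) \<Rightarrow> nat \<Rightarrow> real" where
  "height \<mu> k = (\<Sum>a<k. \<mu> a)"

lemma height_Suc: "height \<mu> (Suc a) = height \<mu> a + \<mu> a"
  by (simp add: height_def)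

lemma height_mono: "(\<And>a. 0 \<le> \<mu> a) \<Longrightarrow> j \<le> k \<Longrightarrow> height \<mu> j \<le> height \<mu> k"
  unfolding height_def by (intro sum_mono2) auto

lemma height_conv_of_bool: "k \<le> n \<Longrightarrow> height \<mu> k = (\<Sum>a<n. \<mu> a * of_bool (a < k))"
  unfolding height_def by (intro sum.mono_neutral_cong_left) auto

text \<open>The weights of the assignment problem. A permutation moving \<open>\<alpha>\<close> to \<open>\<beta>\<close> collects \<open>x \<alpha>\<close> and then
  proceeds from \<open>\<alpha>\<close> to \<open>\<beta>\<close> in one of two ways: ending a chain at \<open>\<alpha>\<close>, at cost \<open>height \<mu> (hi \<alpha>)\<close>,
  and starting a chain at \<open>\<beta>\<close>, with refund \<open>height \<mu> (lo \<beta>)\<close>; or, if \<open>\<alpha> < \<beta>\<close>, continuing the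
  chain for free. A fixed point is either left out, for nothing, or used as a chain of its own. The
  maxima choose the better option.\<close>

definition gain :: "(nat \<Rightarrow> real) \<Rightarrow> ('a \<Rightarrow> real) \<Rightarrow> 'a \<Rightarrow> 'a \<Rightarrow> real" where
  "gain \<mu> x \<alpha> \<beta> =
    (let r = height \<mu> (lo \<beta>) - height \<mu> (hi \<alpha>)
     in if \<alpha> = \<beta> then max 0 (x \<alpha> + r) else x \<alpha> + (if \<alpha> < \<beta> then max 0 r else r))"

lemma gain_closed:
  assumes G: "diff_closed G" and "\<And>\<alpha>. \<alpha> \<in> N \<Longrightarrow> x \<alpha> \<in> G" "\<And>a. \<mu> a \<in> G" "\<alpha> \<in> N"
  shows "gain \<mu> x \<alpha> \<beta> \<in> G"
proof -
  have h: "height \<mu> k \<in> G" for k unfolding height_def by (rule diff_closed_sum[OF G]) (rule assms(3))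
  show ?thesis
    using assms(2)[OF assms(4)] h
    by (auto simp: gain_def Let_def max_def diff_closed_zero[OF G]
        intro!: diff_closed_add[OF G] diff_closed_diff[OF G])
qed

text \<open>The cost of a step, sorted by levels. Level \<open>a\<close> is paid for when the chain leaves a point with
  \<open>a < hi \<alpha>\<close>, refunded when the next point has \<open>a < lo \<beta>\<close>, and free when the chain continues inside
  \<open>layer a\<close>. For \<open>\<alpha> < \<beta>\<close> the free levels are those with \<open>lo \<beta> \<le> a < hi \<alpha>\<close>, by monotonicity of the
  labels; this accounts for both options in the definition of the gain.\<close>

lemma gain_le:
  assumes \<mu>: "\<And>a. 0 \<le> \<mu> a" and N: "\<alpha> \<in> N" "\<beta> \<in> N"
    and ne: "\<alpha> \<noteq> \<beta> \<or> height \<mu> (hi \<alpha>) - height \<mu> (lo \<alpha>) < x \<alpha>"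
  shows "gain \<mu> x \<alpha> \<beta> \<le> x \<alpha> - (\<Sum>a<n. \<mu> a * (of_bool (a < hi \<alpha>) - of_bool (a < lo \<beta>)
      - of_bool (\<alpha> \<in> layer a \<and> \<beta> \<in> layer a \<and> \<alpha> < \<beta>)))"
proof -
  define T where "T = (\<Sum>a<n. \<mu> a * of_bool (\<alpha> \<in> layer a \<and> \<beta> \<in> layer a \<and> \<alpha> < \<beta>))"
  define r where "r = height \<mu> (lo \<beta>) - height \<mu> (hi \<alpha>)"
  have le: "hi \<alpha> \<le> n" "lo \<beta> \<le> n"
    using N hi_le_n lo_less_hi[of \<beta>] hi_le_n[of \<beta>] by (blast, linarith)
  have r: "r = (\<Sum>a<n. \<mu> a * (of_bool (a < lo \<beta>) - of_bool (a < hi \<alpha>)))"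
    using le by (simp add: r_def height_conv_of_bool right_diff_distrib sum_subtractf)
  have rT: "(\<Sum>a<n. \<mu> a * (of_bool (a < hi \<alpha>) - of_bool (a < lo \<beta>)
      - of_bool (\<alpha> \<in> layer a \<and> \<beta> \<in> layer a \<and> \<alpha> < \<beta>))) = - r - T"
    by (simp add: r T_def right_diff_distrib sum_subtractf)
  have T: "0 \<le> T" unfolding T_def using \<mu> by (intro sum_nonneg) auto
  have rT2: "0 \<le> r + T" if "\<alpha> < \<beta>"
  proof -
    have "lo \<alpha> \<le> lo \<beta>" "hi \<alpha> \<le> hi \<beta>" using that N lo_mono hi_mono by auto
    then have "0 \<le> (\<Sum>a<n. \<mu> a * (of_bool (a < lo \<beta>) - of_bool (a < hi \<alpha>)
        + of_bool (\<alpha> \<in> layer a \<and> \<beta> \<in> layer a \<and> \<alpha> < \<beta>)))"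
      using N that \<mu> by (intro sum_nonneg mult_nonneg_nonneg) (auto simp: layer_def)
    then show ?thesis by (simp add: r T_def distrib_left sum.distrib)
  qed
  show ?thesis
    unfolding rT using ne T rT2 by (auto simp: gain_def Let_def r_def)
qed

text \<open>Let \<open>P\<close> be the set of points used by the permutation. Since \<open>\<sigma>\<close> permutes \<open>P\<close>, payments and
  refunds for level \<open>a\<close> add up to the number of points in \<open>P \<inter> layer a\<close>, less the number of links
  \<open>\<alpha> < \<sigma> \<alpha>\<close> inside that set. This is the number of chains into which the links divide the set, hence at least
  its width, and the inequality for \<open>P\<close> applies.\<close>

lemma sum_gain_le:
  assumes \<mu>: "\<And>a. 0 \<le> \<mu> a" and x: "x \<in> polytope \<mu> M" and \<sigma>: "\<sigma> permutes N"
  shows "(\<Sum>\<alpha>\<in>N. gain \<mu> x \<alpha> (\<sigma> \<alpha>)) \<le> M"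
proof -
  define P where "P = {\<alpha> \<in> N. \<sigma> \<alpha> \<noteq> \<alpha> \<or> height \<mu> (hi \<alpha>) - height \<mu> (lo \<alpha>) < x \<alpha>}"
  define E where "E a = {\<alpha> \<in> P. \<alpha> \<in> layer a \<and> \<sigma> \<alpha> \<in> layer a \<and> \<alpha> < \<sigma> \<alpha>}" for a
  have P: "P \<subseteq> N" "finite P" using finite_N by (auto simp: P_def)
  have inj: "inj_on \<sigma> A" for A using permutes_inj[OF \<sigma>] by (rule inj_on_subset) simp
  have \<sigma>N: "\<sigma> \<alpha> \<in> N" if "\<alpha> \<in> N" for \<alpha> using that permutes_in_image[OF \<sigma>] by simp
  have "\<sigma> ` P \<subseteq> P"
    using \<sigma>N permutes_inj[OF \<sigma>] by (auto simp: P_def inj_eq)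
  then have \<sigma>P: "\<sigma> ` P = P" using endo_inj_surj[OF P(2) _ inj] by blast
  have "(\<Sum>\<alpha>\<in>N. gain \<mu> x \<alpha> (\<sigma> \<alpha>)) = (\<Sum>\<alpha>\<in>P. gain \<mu> x \<alpha> (\<sigma> \<alpha>))"
    using finite_N P by (intro sum.mono_neutral_right) (auto simp: P_def gain_def Let_def)
  also have "\<dots> \<le> (\<Sum>\<alpha>\<in>P. x \<alpha> - (\<Sum>a<n. \<mu> a * (of_bool (a < hi \<alpha>) - of_bool (a < lo (\<sigma> \<alpha>))
      - of_bool (\<alpha> \<in> layer a \<and> \<sigma> \<alpha> \<in> layer a \<and> \<alpha> < \<sigma> \<alpha>))))"
    using \<sigma>N by (intro sum_mono gain_le \<mu>) (auto simp: P_def)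
  also have "\<dots> = sum x P - (\<Sum>a<n. \<mu> a * (\<Sum>\<alpha>\<in>P. of_bool (a < hi \<alpha>) - of_bool (a < lo (\<sigma> \<alpha>))
      - of_bool (\<alpha> \<in> layer a \<and> \<sigma> \<alpha> \<in> layer a \<and> \<alpha> < \<sigma> \<alpha>)))"
    by (simp add: sum_subtractf[of x] sum_distrib_left sum.swap[of _ P])
  also have "\<dots> \<le> sum x P - (\<Sum>a<n. \<mu> a * width (P \<inter> layer a))"
  proof (intro diff_left_mono sum_mono mult_left_mono \<mu>)
    fix a
    have "(\<Sum>\<alpha>\<in>P. of_bool (a < hi \<alpha>) - of_bool (a < lo (\<sigma> \<alpha>))
        - of_bool (\<alpha> \<in> layer a \<and> \<sigma> \<alpha> \<in> layer a \<and> \<alpha> < \<sigma> \<alpha>))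
      = (\<Sum>\<alpha>\<in>P. of_bool (a < hi \<alpha>)) - (\<Sum>\<alpha>\<in>P. of_bool (a < lo (\<sigma> \<alpha>))) - real (card (E a))"
      using P(2) by (simp add: sum_subtractf E_def of_bool_def sum.If_cases Int_def)
    also have "(\<Sum>\<alpha>\<in>P. of_bool (a < lo (\<sigma> \<alpha>)) :: real) = (\<Sum>\<alpha>\<in>P. of_bool (a < lo \<alpha>))"
      using sum.reindex[OF inj, of "\<lambda>\<alpha>. of_bool (a < lo \<alpha>) :: real" P] \<sigma>P by simp
    also have "(\<Sum>\<alpha>\<in>P. of_bool (a < hi \<alpha>)) - (\<Sum>\<alpha>\<in>P. of_bool (a < lo \<alpha>))
        = (\<Sum>\<alpha>\<in>P. of_bool (\<alpha> \<in> layer a) :: real)"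
      unfolding sum_subtractf[symmetric]
      using P(1) lo_less_hi by (intro sum.cong) (force simp: layer_def)+
    also have "\<dots> = real (card (P \<inter> layer a))"
      using P(2) by (simp add: of_bool_def sum.If_cases)
    finally have *: "(\<Sum>\<alpha>\<in>P. of_bool (a < hi \<alpha>) - of_bool (a < lo (\<sigma> \<alpha>))
        - of_bool (\<alpha> \<in> layer a \<and> \<sigma> \<alpha> \<in> layer a \<and> \<alpha> < \<sigma> \<alpha>))
      = real (card (P \<inter> layer a)) - real (card (E a))" .
    have "width (P \<inter> layer a) + card (E a) \<le> card (P \<inter> layer a)"
      using P(2) \<sigma>P by (intro width_plus_card_edges_le[OF _ inj]) (auto simp: E_def)
    then show "real (width (P \<inter> layer a)) \<le> (\<Sum>\<alpha>\<in>P. of_bool (a < hi \<alpha>) - of_bool (a < lo (\<sigma> \<alpha>))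
        - of_bool (\<alpha> \<in> layer a \<and> \<sigma> \<alpha> \<in> layer a \<and> \<alpha> < \<sigma> \<alpha>))"
      unfolding * by linarith
  qed
  also have "\<dots> \<le> M" using x P(1) by (auto simp: polytope_def algebra_simps)
  finally show ?thesis .
qed

text \<open>The dual variables are read as positions: \<open>h \<alpha> = x \<alpha> - u \<alpha>\<close> and \<open>l \<beta> = v \<beta>\<close>, up to a
  common shift. The dual constraints for \<open>\<alpha> < \<beta>\<close> then say that the intervals of comparable elements
  are disjoint and in order, those for \<open>\<alpha> = \<beta>\<close> bound the lengths by \<open>x\<close>, and the value of the dual
  solution is the total shortfall.\<close>

lemma interval_representation:
  assumes G: "diff_closed G" and \<mu>: "\<And>a. 0 \<le> \<mu> a" "\<And>a. \<mu> a \<in> G"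
    and x: "x \<in> polytope \<mu> M" "\<And>\<alpha>. \<alpha> \<in> N \<Longrightarrow> x \<alpha> \<in> G"
  obtains l h where "\<And>\<alpha>. \<alpha> \<in> N \<Longrightarrow> l \<alpha> \<in> G" "\<And>\<alpha>. \<alpha> \<in> N \<Longrightarrow> h \<alpha> \<in> G"
    and "\<And>\<alpha> \<beta>. \<alpha> \<in> N \<Longrightarrow> \<beta> \<in> N \<Longrightarrow> \<alpha> < \<beta> \<Longrightarrow> h \<alpha> \<le> l \<beta>"
    and "\<And>\<alpha>. \<alpha> \<in> N \<Longrightarrow> height \<mu> (lo \<alpha>) \<le> l \<alpha>" "\<And>\<alpha>. \<alpha> \<in> N \<Longrightarrow> h \<alpha> \<le> height \<mu> (hi \<alpha>)"
    and "\<And>\<alpha>. \<alpha> \<in> N \<Longrightarrow> h \<alpha> - l \<alpha> \<le> x \<alpha>"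
    and "(\<Sum>\<alpha>\<in>N. x \<alpha> - (h \<alpha> - l \<alpha>)) \<le> M"
proof -
  have hG: "height \<mu> k \<in> G" for k unfolding height_def by (rule diff_closed_sum[OF G]) (rule \<mu>)
  have gG: "gain \<mu> x a b \<in> G" if "a \<in> N" "b \<in> N" for a b
    by (rule gain_closed[of G x \<mu>, OF G x(2) \<mu>(2) that(1)])
  obtain \<sigma> u v where \<sigma>: "\<sigma> permutes N"
    and uG: "\<And>a. a \<in> N \<Longrightarrow> u a \<in> G" and vG: "\<And>a. a \<in> N \<Longrightarrow> v a \<in> G"
    and ge: "\<And>a b. a \<in> N \<Longrightarrow> b \<in> N \<Longrightarrow> gain \<mu> x a b \<le> u a + v b"
    and eq: "sum u N + sum v N = (\<Sum>a\<in>N. gain \<mu> x a (\<sigma> a))"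
    using assignment_duality[of N G "gain \<mu> x", OF finite_N G gG] by blast
  have uv: "height \<mu> (lo \<beta>) - height \<mu> (hi \<alpha>) + x \<alpha> \<le> u \<alpha> + v \<beta>" if "\<alpha> \<in> N" "\<beta> \<in> N" for \<alpha> \<beta>
    using ge[OF that] by (auto simp: gain_def Let_def split: if_splits)
  \<comment> \<open>By the constraints \<open>uv\<close>, every excess of \<open>x \<alpha> - u \<alpha>\<close> over \<open>height \<mu> (hi \<alpha>)\<close> is at most
    every \<open>v \<beta> - height \<mu> (lo \<beta>)\<close>. Shifting by the largest excess places all intervals.\<close>
  define K where "K = Max ((\<lambda>\<alpha>. x \<alpha> - u \<alpha> - height \<mu> (hi \<alpha>)) ` N)"
  define h where "h \<alpha> = x \<alpha> - u \<alpha> - K" for \<alpha>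
  define l where "l \<alpha> = v \<alpha> - K" for \<alpha>
  have K: "\<exists>\<alpha>\<in>N. K = x \<alpha> - u \<alpha> - height \<mu> (hi \<alpha>)" if "N \<noteq> {}"
  proof -
    have "K \<in> (\<lambda>\<alpha>. x \<alpha> - u \<alpha> - height \<mu> (hi \<alpha>)) ` N"
      unfolding K_def using that finite_N by (intro Max_in) auto
    then show ?thesis by auto
  qed
  have KG: "K \<in> G" if "\<alpha> \<in> N" for \<alpha>
    using K that x(2) uG hG by (metis diff_closed_diff[OF G] empty_iff)
  show thesis
  proof
    show "l \<alpha> \<in> G" if "\<alpha> \<in> N" for \<alpha>
      unfolding l_def using that by (intro diff_closed_diff[OF G] vG KG)
    show "h \<alpha> \<in> G" if "\<alpha> \<in> N" for \<alpha>
      unfolding h_def using that by (intro diff_closed_diff[OF G] uG x KG)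
    show "h \<alpha> \<le> l \<beta>" if "\<alpha> \<in> N" "\<beta> \<in> N" "\<alpha> < \<beta>" for \<alpha> \<beta>
      using ge[OF that(1,2)] that(3) by (auto simp: gain_def Let_def h_def l_def split: if_splits)
    show "height \<mu> (lo \<beta>) \<le> l \<beta>" if "\<beta> \<in> N" for \<beta>
      using K uv that by (force simp: l_def)
    show "h \<alpha> \<le> height \<mu> (hi \<alpha>)" if "\<alpha> \<in> N" for \<alpha>
    proof -
      have "x \<alpha> - u \<alpha> - height \<mu> (hi \<alpha>) \<le> K"
        unfolding K_def using that finite_N by (intro Max_ge) auto
      then show ?thesis by (simp add: h_def)
    qed
    show "h \<alpha> - l \<alpha> \<le> x \<alpha>" if "\<alpha> \<in> N" for \<alpha>
      using ge[OF that that] by (auto simp: gain_def Let_def h_def l_def)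
    have "(\<Sum>\<alpha>\<in>N. x \<alpha> - (h \<alpha> - l \<alpha>)) = sum u N + sum v N"
      by (simp add: h_def l_def sum.distrib[symmetric])
    then show "(\<Sum>\<alpha>\<in>N. x \<alpha> - (h \<alpha> - l \<alpha>)) \<le> M"
      using eq sum_gain_le[OF \<mu>(1) x(1) \<sigma>] by simp
  qed
qed

lemma sum_overlap_height:
  assumes "\<And>a. 0 \<le> \<mu> a"
  shows "(\<Sum>a<k. overlap l h (height \<mu> a) (height \<mu> (Suc a))) = overlap l h 0 (height \<mu> k)"
proof (induction k)
  case 0
  show ?case by (auto simp: height_def overlap_def)
next
  case (Suc k)
  have "0 \<le> height \<mu> k" using assms by (simp add: height_def sum_nonneg)
  then show ?case
    using Suc assms[of k] by (simp add: overlap_add height_Suc)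
qed

text \<open>One piece \<open>[p a, q a)\<close> is selected inside the segment of each level \<open>a\<close>. An interval meeting this
  segment belongs to an element of \<open>layer a\<close>, as it lies between the heights of its labels. The
  term \<open>z\<close> is absorbed by \<open>M\<close>, which occurs in the inequality of every subset.\<close>

lemma sum_overlaps_in_polytope:
  assumes \<mu>: "\<And>a. 0 \<le> \<mu> a"
    and ord: "\<And>\<alpha> \<beta>. \<alpha> \<in> N \<Longrightarrow> \<beta> \<in> N \<Longrightarrow> \<alpha> < \<beta> \<Longrightarrow> h \<alpha> \<le> l \<beta>"
    and l: "\<And>\<alpha>. \<alpha> \<in> N \<Longrightarrow> height \<mu> (lo \<alpha>) \<le> l \<alpha>"
    and h: "\<And>\<alpha>. \<alpha> \<in> N \<Longrightarrow> h \<alpha> \<le> height \<mu> (hi \<alpha>)"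
    and p: "\<And>a. height \<mu> a \<le> p a" and q: "\<And>a. q a \<le> height \<mu> (Suc a)"
    and pq: "\<And>a. p a \<le> q a"
    and z: "\<And>\<alpha>. \<alpha> \<in> N \<Longrightarrow> 0 \<le> z \<alpha>" "sum z N \<le> M"
  shows "(\<lambda>\<alpha>. if \<alpha> \<in> N then (\<Sum>a<n. overlap (l \<alpha>) (h \<alpha>) (p a) (q a)) + z \<alpha> else 0)
    \<in> polytope (\<lambda>a. q a - p a) M"
proof -
  let ?x = "\<lambda>\<alpha>. if \<alpha> \<in> N then (\<Sum>a<n. overlap (l \<alpha>) (h \<alpha>) (p a) (q a)) + z \<alpha> else 0"
  have "sum ?x P \<le> M + (\<Sum>a<n. (q a - p a) * width (P \<inter> layer a))" if P: "P \<subseteq> N" for P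
  proof -
    have finP: "finite P" using P finite_N finite_subset by blast
    have "sum ?x P = (\<Sum>\<alpha>\<in>P. (\<Sum>a<n. overlap (l \<alpha>) (h \<alpha>) (p a) (q a)) + z \<alpha>)"
      using P by (intro sum.cong) auto
    also have "\<dots> = (\<Sum>a<n. \<Sum>\<alpha>\<in>P. overlap (l \<alpha>) (h \<alpha>) (p a) (q a)) + sum z P"
      by (simp add: sum.distrib sum.swap[of _ P])
    also have "\<dots> \<le> (\<Sum>a<n. (q a - p a) * width (P \<inter> layer a)) + M"
    proof (intro add_mono sum_mono sum_overlap_le_width)
      have "sum z P \<le> sum z N" using P z(1) finite_N by (intro sum_mono2) auto
      then show "sum z P \<le> M" using z(2) by simp
    next
      fix a \<alpha> t
      assume \<alpha>: "\<alpha> \<in> P" and t: "l \<alpha> \<le> t" "t < h \<alpha>" "p a \<le> t" "t < q a"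
      have \<alpha>N: "\<alpha> \<in> N" using \<alpha> P by auto
      have "height \<mu> a < height \<mu> (hi \<alpha>)" using h[OF \<alpha>N] p[of a] t by linarith
      then have "a < hi \<alpha>" using height_mono[of \<mu>, OF \<mu>] by (meson leD not_le)
      moreover have "height \<mu> (lo \<alpha>) < height \<mu> (Suc a)" using l[OF \<alpha>N] q[of a] t by linarith
      then have "lo \<alpha> \<le> a" using height_mono[of \<mu>, OF \<mu>] by (meson leD not_less_eq_eq)
      ultimately show "\<alpha> \<in> layer a" using \<alpha>N by (simp add: layer_def)
    qed (use finP P pq in \<open>auto intro: ord\<close>)
    finally show ?thesis by simp
  qed
  then show ?thesis
    using z(1) by (auto simp: polytope_def intro!: add_nonneg_nonneg sum_nonneg overlap_nonneg)
qed

lemma polytope_decomposition: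
  assumes G: "diff_closed G"
    and m: "\<And>a. 0 \<le> m a" "\<And>a. m a \<in> G" "\<And>a. 0 \<le> m' a" "\<And>a. m' a \<in> G"
    and M: "0 \<le> M" "M \<in> G" "0 \<le> M'" "M' \<in> G"
    and x: "x \<in> polytope (m + m') (M + M')" "\<And>\<alpha>. \<alpha> \<in> N \<Longrightarrow> x \<alpha> \<in> G"
  obtains y y' where "y \<in> polytope m M" "\<And>\<alpha>. \<alpha> \<in> N \<Longrightarrow> y \<alpha> \<in> G"
    and "y' \<in> polytope m' M'" "\<And>\<alpha>. \<alpha> \<in> N \<Longrightarrow> y' \<alpha> \<in> G" and "x = y + y'"
proof -
  define \<mu> where "\<mu> = m + m'"
  have \<mu>: "0 \<le> \<mu> a" "\<mu> a \<in> G" for a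
    using m by (auto simp: \<mu>_def intro: diff_closed_add[OF G])
  have hG: "height \<mu> k \<in> G" for k unfolding height_def by (rule diff_closed_sum[OF G]) (rule \<mu>)
  obtain l h where lG: "\<And>\<alpha>. \<alpha> \<in> N \<Longrightarrow> l \<alpha> \<in> G" and hG': "\<And>\<alpha>. \<alpha> \<in> N \<Longrightarrow> h \<alpha> \<in> G"
    and ord: "\<And>\<alpha> \<beta>. \<alpha> \<in> N \<Longrightarrow> \<beta> \<in> N \<Longrightarrow> \<alpha> < \<beta> \<Longrightarrow> h \<alpha> \<le> l \<beta>"
    and l: "\<And>\<alpha>. \<alpha> \<in> N \<Longrightarrow> height \<mu> (lo \<alpha>) \<le> l \<alpha>"
    and h: "\<And>\<alpha>. \<alpha> \<in> N \<Longrightarrow> h \<alpha> \<le> height \<mu> (hi \<alpha>)"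
    and len: "\<And>\<alpha>. \<alpha> \<in> N \<Longrightarrow> h \<alpha> - l \<alpha> \<le> x \<alpha>"
    and slack: "(\<Sum>\<alpha>\<in>N. x \<alpha> - (h \<alpha> - l \<alpha>)) \<le> M + M'"
    by (rule interval_representation[OF G \<mu> x[folded \<mu>_def]]) blast+
  \<comment> \<open>Nothing forces \<open>l \<alpha> \<le> h \<alpha>\<close>; an interval with \<open>h \<alpha> < l \<alpha>\<close> is empty, of length 0.\<close>
  define z where "z \<alpha> = x \<alpha> - max 0 (h \<alpha> - l \<alpha>)" for \<alpha>
  have z: "0 \<le> z \<alpha>" "z \<alpha> \<in> G" if "\<alpha> \<in> N" for \<alpha>
    using len[OF that] x(1) that x(2) lG hG'
    by (auto simp: z_def polytope_def max_def intro!: diff_closed_diff[OF G] diff_closed_zero[OF G])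
  have "sum z N \<le> M + M'"
    by (rule order_trans[OF sum_mono slack]) (auto simp: z_def)
  then have "\<exists>w. (\<forall>\<alpha>\<in>N. 0 \<le> w \<alpha> \<and> w \<alpha> \<le> z \<alpha> \<and> w \<alpha> \<in> G)
      \<and> sum w N \<le> M \<and> (\<Sum>\<alpha>\<in>N. z \<alpha> - w \<alpha>) \<le> M'"
    using z M by (intro split_under_budget finite_N G)
  then obtain w where w_all: "\<forall>\<alpha>\<in>N. 0 \<le> w \<alpha> \<and> w \<alpha> \<le> z \<alpha> \<and> w \<alpha> \<in> G"
    and sums: "sum w N \<le> M" "(\<Sum>\<alpha>\<in>N. z \<alpha> - w \<alpha>) \<le> M'"
    by blast
  from w_all have w: "0 \<le> w \<alpha>" "w \<alpha> \<le> z \<alpha>" "w \<alpha> \<in> G" if "\<alpha> \<in> N" for \<alpha>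
    using that by auto
  \<comment> \<open>The cut dividing level \<open>a\<close> into its share for \<open>m\<close> and its share for \<open>m'\<close>.\<close>
  define b where "b a = height \<mu> a + m a" for a
  have b: "height \<mu> a \<le> b a" "b a \<le> height \<mu> (Suc a)" "b a \<in> G" for a
    using m hG by (auto simp: b_def height_Suc \<mu>_def intro: diff_closed_add[OF G])
  have bm: "(\<lambda>a. b a - height \<mu> a) = m" "(\<lambda>a. height \<mu> (Suc a) - b a) = m'"
    by (auto simp: b_def height_Suc \<mu>_def)
  define y where "y \<alpha> = (if \<alpha> \<in> N then
    (\<Sum>a<n. overlap (l \<alpha>) (h \<alpha>) (height \<mu> a) (b a)) + w \<alpha> else 0)" for \<alpha>
  define y' where "y' \<alpha> = (if \<alpha> \<in> N then
    (\<Sum>a<n. overlap (l \<alpha>) (h \<alpha>) (b a) (height \<mu> (Suc a))) + (z \<alpha> - w \<alpha>) else 0)" for \<alpha>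
  show thesis
  proof
    show "y \<in> polytope m M"
      using sum_overlaps_in_polytope[of \<mu> h l "height \<mu>" b w M, OF \<mu>(1) ord l h order_refl b(2,1) w(1) sums(1)]
      unfolding bm y_def .
    show "y' \<in> polytope m' M'"
      using sum_overlaps_in_polytope[of \<mu> h l b "\<lambda>a. height \<mu> (Suc a)" "\<lambda>\<alpha>. z \<alpha> - w \<alpha>" M',
          OF \<mu>(1) ord l h b(1) order_refl b(2) _ sums(2)] w(2)
      unfolding bm y'_def by simp
    show "y \<alpha> \<in> G" "y' \<alpha> \<in> G" if "\<alpha> \<in> N" for \<alpha>
      using that w(3) z(2) lG hG' hG b(3) unfolding y_def y'_def
      by (auto intro!: diff_closed_add[OF G] diff_closed_diff[OF G] diff_closed_sum[OF G] overlap_closed[OF G])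
    show "x = y + y'"
    proof
      fix \<alpha>
      show "x \<alpha> = (y + y') \<alpha>"
      proof (cases "\<alpha> \<in> N")
        case True
        have "0 \<le> height \<mu> (lo \<alpha>)" "height \<mu> (hi \<alpha>) \<le> height \<mu> n"
          using \<mu> hi_le_n[OF True] by (auto simp: height_def intro: sum_nonneg height_mono[unfolded height_def])
        then have "0 \<le> l \<alpha>" "h \<alpha> \<le> height \<mu> n" using l[OF True] h[OF True] by auto
        then have "overlap (l \<alpha>) (h \<alpha>) 0 (height \<mu> n) = x \<alpha> - z \<alpha>"
          by (simp add: overlap_def z_def)
        moreover have "(y + y') \<alpha> = (\<Sum>a<n. overlap (l \<alpha>) (h \<alpha>) (height \<mu> a) (height \<mu> (Suc a))) + z \<alpha>"
          using True b overlap_add[OF b(1,2)] by (simp add: y_def y'_def sum.distrib[symmetric])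
        ultimately show ?thesis by (simp add: sum_overlap_height[of \<mu>, OF \<mu>(1)])
      next
        case False
        then show ?thesis using x(1) by (simp add: polytope_def y_def y'_def)
      qed
    qed
  qed
qed

lemma polytope_Minkowski_sum:
  assumes G: "diff_closed G"
    and m: "\<And>a. 0 \<le> m a" "\<And>a. m a \<in> G" "\<And>a. 0 \<le> m' a" "\<And>a. m' a \<in> G"
    and M: "0 \<le> M" "M \<in> G" "0 \<le> M'" "M' \<in> G"
  shows "(polytope m M \<inter> {x. \<forall>\<alpha>\<in>N. x \<alpha> \<in> G}) + (polytope m' M' \<inter> {x. \<forall>\<alpha>\<in>N. x \<alpha> \<in> G})
    = polytope (m + m') (M + M') \<inter> {x. \<forall>\<alpha>\<in>N. x \<alpha> \<in> G}" (is "?A + ?B = ?C")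
proof
  show "?A + ?B \<subseteq> ?C"
    by (auto elim!: set_plus_elim intro!: polytope_add diff_closed_add[OF G])
  show "?C \<subseteq> ?A + ?B"
  proof
    fix x assume x: "x \<in> ?C"
    obtain y y' where "y \<in> ?A" "y' \<in> ?B" "x = y + y'"
      by (rule polytope_decomposition[OF G m M, of x]) (use x in auto)
    then show "x \<in> ?A + ?B" by auto
  qed
qed

end

section \<open>Strictly lower triangular positions\<close>

lemma P_union_iff: "\<alpha> \<in> P_union n d \<longleftrightarrow> (\<exists>a\<in>set d. \<alpha> \<in> P_single n a)"
  by (fastforce simp: P_union_def in_set_conv_nth)

lemma interval_labelled_P_union: "interval_labelled_poset (P_union n d) snd fst n"
proof
  have "P_union n d \<subseteq> {..n} \<times> {..n}"
    by (auto simp: P_union_iff P_single_def P_all_def)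
  then show "finite (P_union n d)" by (rule finite_subset) simp
qed (auto simp: P_union_iff P_single_def P_all_def less_eq_prod_def)

text \<open>The sums in \<open>polytope\<close> run over all levels below \<open>n\<close>; levels outside \<open>D\<close> get weight 0.\<close>

definition extend_by_zero :: "nat set \<Rightarrow> (nat \<Rightarrow> nat) \<Rightarrow> nat \<Rightarrow> real" where
  "extend_by_zero D m a = (if a \<in> D then real (m a) else 0)"

lemma X_set_eq_polytope:
  assumes d: "sorted_wrt (<) d" "\<forall>k\<in>set d. 1 \<le> k \<and> k < n"
  shows "X_set n d m M =
    interval_labelled_poset.polytope (P_union n d) snd fst n (extend_by_zero (set d) m) M"
proof -
  interpret interval_labelled_poset "P_union n d" snd fst n by (rule interval_labelled_P_union)
  have layer: "layer a = P_single n a" if "a \<in> set d" for a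
    using that by (auto simp: layer_def P_union_iff P_single_def)
  have "(\<Sum>i<length d. real (m (d ! i)) * real (width (P \<inter> P_single n (d ! i))))
      = (\<Sum>a<n. extend_by_zero (set d) m a * width (P \<inter> layer a))" for P
  proof -
    have "distinct d" using d(1) by (simp add: strict_sorted_iff)
    then have "(\<Sum>i<length d. real (m (d ! i)) * real (width (P \<inter> P_single n (d ! i))))
        = (\<Sum>a\<in>set d. real (m a) * real (width (P \<inter> P_single n a)))"
      by (intro sum.reindex_bij_betw[OF bij_betw_nth]) auto
    also have "\<dots> = (\<Sum>a<n. extend_by_zero (set d) m a * width (P \<inter> layer a))"
      using d(2) by (intro sum.mono_neutral_cong_left) (auto simp: extend_by_zero_def layer)
    finally show ?thesis .
  qed
  then show ?thesis by (simp add: X_set_def polytope_def)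
qed

theorem theorem4p4:
  fixes n :: nat and d :: "nat list" and m m' :: "nat \<Rightarrow> nat" and M M' :: nat
  assumes "n \<ge> 2"
    and "sorted_wrt (<) d"
    and "\<forall>k\<in>set d. 1 \<le> k \<and> k < n"
    and "\<forall>i\<in>{1..<n}. i \<notin> set d \<longrightarrow> m i = 0"
    and "\<forall>i\<in>{1..<n}. i \<notin> set d \<longrightarrow> m' i = 0"
  shows "S_set n d m M + S_set n d m' M' = S_set n d (m + m') (M + M') \<and>
    X_set n d m M + X_set n d m' M' = X_set n d (m + m') (M + M')"
proof -
  interpret interval_labelled_poset "P_union n d" snd fst n by (rule interval_labelled_P_union)
  let ?e = "extend_by_zero (set d)"
  have e: "?e (m + m') = ?e m + ?e m'" by (auto simp: extend_by_zero_def)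
  have ge: "0 \<le> ?e k a" and int: "?e k a \<in> \<int>" for k a by (auto simp: extend_by_zero_def)
  have "diff_closed (\<int> :: real set)" "diff_closed (UNIV :: real set)" by (auto simp: diff_closed_def)
  from this[THEN polytope_Minkowski_sum, of "?e m" "?e m'" M M'] show ?thesis
    by (simp add: S_set_def X_set_eq_polytope[OF assms(2,3)] e ge int)
qed

end
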